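(* Let $G$ be a connected strongly regular graph with parameters $(n,k,\lambda,\mu)$, with $k\geq 3$, and suppose that $\lambda=0$ or $\lambda=1$. Then the Gallai graph $\Gamma(G)$ is $2$-connected.
   Context: All graphs are finite and simple. A $k$-regular graph $G$ on $n$ vertices is strongly regular with parameters $(n,k,\lambda,\mu)$ if $G$ is neither complete nor empty, any two adjacent vertices have exactly $\lambda$ common neighbours, and any two non-adjacent vertices have exactly $\mu$ common neighbours. The Gallai graph $\Gamma(G)$ has the edges of $G$ as vertices, two being adjacent iff the corresponding edges of $G$ share a vertex but do not lie on a common triangle of $G$. A graph is $2$-connected if it is connected and removing any single vertex leaves it connected. *)

theory Defs
  imports "Graph_Theory.Graph_Theory"
begin

text \<open>Finite simple graphs are rendered as \<^locale>\<open>pair_graph\<close>: finite, symmetric, loop-free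
  digraphs whose arcs are ordered pairs of vertices. Hence the degree of a vertex is its
  out-degree, and every undirected edge \<open>{u, v}\<close> corresponds to the two arcs \<open>(u, v)\<close>
  and \<open>(v, u)\<close>.\<close>

definition common_neighbours :: "'a pair_pre_digraph \<Rightarrow> 'a \<Rightarrow> 'a \<Rightarrow> 'a set" where
  "common_neighbours G u v = {w \<in> pverts G. (u, w) \<in> parcs G \<and> (v, w) \<in> parcs G}"

definition strongly_regular ::
  "'a pair_pre_digraph \<Rightarrow> nat \<Rightarrow> nat \<Rightarrow> nat \<Rightarrow> nat \<Rightarrow> bool" where
  "strongly_regular G n k l m \<longleftrightarrow>
     pair_graph G \<and>
     card (pverts G) = n \<and>
     (\<forall>v \<in> pverts G. out_degree (with_proj G) v = k) \<and>
     \<not> complete_digraph n (with_proj G) \<and>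
     parcs G \<noteq> {} \<and>
     (\<forall>u \<in> pverts G. \<forall>v \<in> pverts G. (u, v) \<in> parcs G \<longrightarrow>
        card (common_neighbours G u v) = l) \<and>
     (\<forall>u \<in> pverts G. \<forall>v \<in> pverts G. u \<noteq> v \<longrightarrow> (u, v) \<notin> parcs G \<longrightarrow>
        card (common_neighbours G u v) = m)"

definition undirected_edges :: "'a pair_pre_digraph \<Rightarrow> 'a set set" where
  "undirected_edges G = {{u, v} | u v. (u, v) \<in> parcs G}"

text \<open>Since \<open>G\<close> is loop-free, the three vertices below are automatically distinct.\<close>

definition on_common_triangle :: "'a pair_pre_digraph \<Rightarrow> 'a set \<Rightarrow> 'a set \<Rightarrow> bool" where
  "on_common_triangle G e f \<longleftrightarrow>
     (\<exists>x y z. (x, y) \<in> parcs G \<and> (y, z) \<in> parcs G \<and> (z, x) \<in> parcs G \<and>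
        e \<in> {{x, y}, {y, z}, {z, x}} \<and> f \<in> {{x, y}, {y, z}, {z, x}})"

definition gallai_graph :: "'a pair_pre_digraph \<Rightarrow> 'a set pair_pre_digraph" where
  "gallai_graph G =
     \<lparr> pverts = undirected_edges G,
       parcs = {(e, f). e \<in> undirected_edges G \<and> f \<in> undirected_edges G \<and>
                  e \<noteq> f \<and> e \<inter> f \<noteq> {} \<and> \<not> on_common_triangle G e f} \<rparr>"

lemma pair_graph_gallai_graph:
  assumes "pair_graph G"
  shows "pair_graph (gallai_graph G)"
proof -
  interpret pair_graph G by fact
  have "undirected_edges G = (\<lambda>(u, v). {u, v}) ` parcs G"
    by (auto simp: undirected_edges_def)
  then have fin: "finite (undirected_edges G)"
    by simp
  have "finite (parcs (gallai_graph G))"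
    by (rule finite_subset[OF _ finite_cartesian_product[OF fin fin]])
      (auto simp: gallai_graph_def)
  moreover have "on_common_triangle G e f \<longleftrightarrow> on_common_triangle G f e" for e f
    by (auto simp: on_common_triangle_def)
  ultimately show ?thesis
    using fin by unfold_locales (auto simp: gallai_graph_def symmetric_def sym_def)
qed

text \<open>The constant \<open>connected\<close> excludes the graph without vertices, so a single vertex
  is not two-connected under this definition, whereas a single edge is.\<close>

definition two_connected :: "('a, 'b) pre_digraph \<Rightarrow> bool" where
  "two_connected G \<longleftrightarrow>
     Digraph_Component.connected G \<and>
     (\<forall>v \<in> verts G. Digraph_Component.connected (pre_digraph.del_vert G v))"

end

theory Submission
  imports Defs
begin

text \<open>At each vertex \<open>v\<close> the neighbourhood spans a graph of maximum degree at most one, so the edges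
  at \<open>v\<close> induce in the Gallai graph a complete graph on at least three vertices (\<open>\<lambda> = 0\<close>) or a
  complete multipartite graph with at least two parts, all of size two (\<open>\<lambda> = 1\<close>). Both stay
  connected when a vertex is deleted. Moreover every edge \<open>e\<close> of \<open>G\<close> lies on a cycle of length three
  or four, so \<open>G - e\<close> is connected, and a walk in \<open>G - e\<close> links the stars of its vertices inside
  \<open>\<Gamma>(G) - e\<close>. Taking for \<open>e\<close> a set that is not an edge gives the connectedness of \<open>\<Gamma>(G)\<close>.\<close>

lemma (in wf_digraph) connectedI_rtrancl:
  assumes "verts G \<noteq> {}"
    and "\<And>u v. u \<in> verts G \<Longrightarrow> v \<in> verts G \<Longrightarrow> (u, v) \<in> (arcs_ends G)\<^sup>*"
  shows "Digraph_Component.connected G"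
  unfolding Digraph_Component.connected_def
  using assms by (intro strongly_connectedI)
    (auto intro!: reachable_mk_symmetricI simp: reachable_conv)

text \<open>Comparing vertex sets removes both orientations of \<open>e\<close> at once; an
  \<open>e\<close> that is not an edge removes nothing.\<close>

definition edge_deleted_arcs :: "'a pair_pre_digraph \<Rightarrow> 'a set \<Rightarrow> 'a rel" where
  "edge_deleted_arcs G e = {(u, v) \<in> parcs G. {u, v} \<noteq> e}"

definition gallai_deleted_arcs :: "'a pair_pre_digraph \<Rightarrow> 'a set \<Rightarrow> 'a set rel" where
  "gallai_deleted_arcs G e = {(f, g) \<in> parcs (gallai_graph G). f \<noteq> e \<and> g \<noteq> e}"

lemma arcs_ends_del_vert_gallai_graph:
  "arcs_ends (pre_digraph.del_vert (with_proj (gallai_graph G)) e) = gallai_deleted_arcs G e"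
  by (auto simp: arcs_ends_conv pre_digraph.del_vert_simps gallai_deleted_arcs_def)

lemma edge_in_undirected_edges: "(u, v) \<in> parcs G \<Longrightarrow> {u, v} \<in> undirected_edges G"
  by (auto simp: undirected_edges_def)

text \<open>Two distinct sides of a triangle that meet at \<open>v\<close> determine the third side,
  which joins their other ends.\<close>

lemma (in pair_graph) on_common_triangle_star:
  assumes "on_common_triangle G {v, x} {v, y}" and "x \<noteq> y"
  shows "(x, y) \<in> parcs G"
  using assms unfolding on_common_triangle_def
  by (elim exE conjE) (auto simp: doubleton_eq_iff dest: arcs_symmetric no_loops')

lemma (in pair_graph) star_gallai_deleted_arc:
  assumes "(v, x) \<in> parcs G" "(v, y) \<in> parcs G" "x \<noteq> y" "(x, y) \<notin> parcs G"
    and "{v, x} \<noteq> e" "{v, y} \<noteq> e"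
  shows "({v, x}, {v, y}) \<in> gallai_deleted_arcs G e"
  using assms on_common_triangle_star[of v x y] edge_in_undirected_edges[of v]
  by (auto simp: gallai_deleted_arcs_def gallai_graph_def doubleton_eq_iff)

locale sparse_srg = pair_graph G for G :: "'a pair_pre_digraph" +
  fixes k l m :: nat
  assumes degree: "v \<in> pverts G \<Longrightarrow> out_degree (with_proj G) v = k"
    and k_ge_3: "k \<ge> 3"
    and adjacent: "(u, v) \<in> parcs G \<Longrightarrow> card (common_neighbours G u v) = l"
    and nonadjacent: "u \<in> pverts G \<Longrightarrow> v \<in> pverts G \<Longrightarrow> u \<noteq> v \<Longrightarrow> (u, v) \<notin> parcs G \<Longrightarrow>
      card (common_neighbours G u v) = m"
    and l_01: "l = 0 \<or> l = 1"
begin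

lemma finite_common_neighbours: "finite (common_neighbours G u v)"
  by (simp add: common_neighbours_def pair_finite_verts)

lemma third_neighbour:
  assumes "v \<in> pverts G"
  obtains z where "(v, z) \<in> parcs G" "z \<noteq> x" "z \<noteq> y"
proof -
  have "\<exists>z. (v, z) \<in> parcs G \<and> z \<noteq> x \<and> z \<noteq> y"
  proof (rule ccontr)
    assume "\<not> ?thesis"
    then have "out_arcs (with_proj G) v \<subseteq> {(v, x), (v, y)}"
      by (auto simp: out_arcs_def)
    then have "out_degree (with_proj G) v \<le> card {(v, x), (v, y)}"
      unfolding out_degree_def by (intro card_mono) auto
    also have "\<dots> \<le> 2"
      by (simp add: card_insert_if)
    finally show False
      using degree[OF assms] k_ge_3 by simp
  qed
  with that show thesis by blast
qed

text \<open>As \<lambda> \<le> 1, each edge has at most one common neighbour of its ends. Read at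
  \<open>u\<close>, adjacency among the neighbours of \<open>u\<close> is a matching.\<close>

lemma triangle_unique:
  assumes "(u, v) \<in> parcs G" "(u, x) \<in> parcs G" "(v, x) \<in> parcs G"
    and "(u, y) \<in> parcs G" "(v, y) \<in> parcs G"
  shows "x = y"
proof -
  have "card (common_neighbours G u v) \<le> Suc 0"
    using adjacent[OF assms(1)] l_01 by auto
  moreover have "x \<in> common_neighbours G u v" "y \<in> common_neighbours G u v"
    using assms by (auto simp: common_neighbours_def in_arcsD2)
  ultimately show ?thesis
    using finite_common_neighbours by (auto simp: card_le_Suc0_iff_eq)
qed

lemma triangle_exists:
  assumes "l = 1" "(u, v) \<in> parcs G"
  obtains w where "(u, w) \<in> parcs G" "(v, w) \<in> parcs G"
proof -
  have "common_neighbours G u v \<noteq> {}"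
    using adjacent[OF assms(2)] assms(1) by auto
  with that show thesis by (auto simp: common_neighbours_def)
qed

lemma no_triangle:
  assumes "l = 0" "(u, v) \<in> parcs G" "(u, w) \<in> parcs G"
  shows "(v, w) \<notin> parcs G"
proof -
  have "common_neighbours G u v = {}"
    using adjacent[OF assms(2)] assms(1) finite_common_neighbours by simp
  with assms(3) show ?thesis
    by (auto simp: common_neighbours_def in_arcsD2)
qed

text \<open>Edges at \<open>v\<close> with distinct nonadjacent other ends are adjacent in the
  Gallai graph. If \<open>x\<close> and \<open>y\<close> are adjacent, a detour through one further
  edge at \<open>v\<close> is found.\<close>

lemma star_connected:
  assumes vx: "(v, x) \<in> parcs G" "{v, x} \<noteq> e" and vy: "(v, y) \<in> parcs G" "{v, y} \<noteq> e"
  shows "({v, x}, {v, y}) \<in> (gallai_deleted_arcs G e)\<^sup>*"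
proof (cases "x = y \<or> (x, y) \<notin> parcs G")
  case True
  then show ?thesis
    using star_gallai_deleted_arc[OF vx(1) vy(1) _ _ vx(2) vy(2)] by auto
next
  case False
  then have xy: "x \<noteq> y" "(x, y) \<in> parcs G" by auto
  have "l = 1"
    using no_triangle[OF _ vx(1) vy(1)] xy l_01 by auto
  \<comment> \<open>The triangle \<open>v\<close>, \<open>z\<close>, \<open>w\<close> supplies two
    candidates for the detour. Since \<open>x\<close> and \<open>y\<close> are already matched to
    each other, neither \<open>z\<close> nor \<open>w\<close> is adjacent to them.\<close>
  obtain z where z: "(v, z) \<in> parcs G" "z \<noteq> x" "z \<noteq> y"
    using third_neighbour in_arcsD1[OF vx(1)] .
  obtain w where w: "(v, w) \<in> parcs G" "(z, w) \<in> parcs G"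
    using triangle_exists[OF \<open>l = 1\<close> z(1)] .
  have zxy: "(x, z) \<notin> parcs G" "(z, y) \<notin> parcs G"
    using triangle_unique[of v x z y] triangle_unique[of v y z x] vx vy z xy
    by (auto dest: arcs_symmetric)
  then have "w \<noteq> x" "w \<noteq> y" "w \<noteq> z"
    using w by (auto dest: arcs_symmetric no_loops')
  have wxy: "(x, w) \<notin> parcs G" "(w, y) \<notin> parcs G"
    using triangle_unique[of v x w y] triangle_unique[of v y w x] vx vy w xy \<open>w \<noteq> x\<close> \<open>w \<noteq> y\<close>
    by (auto dest: arcs_symmetric)
  \<comment> \<open>At most one of \<open>{v, z}\<close> and \<open>{v, w}\<close> equals
    \<open>e\<close>; the other one serves.\<close>
  have "\<exists>t. (v, t) \<in> parcs G \<and> t \<noteq> x \<and> t \<noteq> y \<and> {v, t} \<noteq> e \<and> (x, t) \<notin> parcs G \<and> (t, y) \<notin> parcs G"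
  proof (cases "{v, z} = e")
    case True
    then have "{v, w} \<noteq> e"
      using \<open>w \<noteq> z\<close> by (auto simp: doubleton_eq_iff)
    then show ?thesis
      using w wxy \<open>w \<noteq> x\<close> \<open>w \<noteq> y\<close> by blast
  next
    case False
    then show ?thesis
      using z zxy by blast
  qed
  then obtain t where t: "(v, t) \<in> parcs G" "t \<noteq> x" "t \<noteq> y" "{v, t} \<noteq> e"
    "(x, t) \<notin> parcs G" "(t, y) \<notin> parcs G"
    by blast
  have "({v, x}, {v, t}) \<in> gallai_deleted_arcs G e" "({v, t}, {v, y}) \<in> gallai_deleted_arcs G e"
    using t vx vy by (auto intro!: star_gallai_deleted_arc)
  then show ?thesis
    by (meson converse_rtrancl_into_rtrancl r_into_rtrancl)
qed

text \<open>If \<open>{u, v}\<close> is \<open>e\<close>, it is bypassed along the rest of a cycle: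
  a triangle for \<lambda> = 1, a cycle of length four or five for \<lambda> = 0. Length five cannot
  be avoided in the Petersen graph.\<close>

lemma ends_connected_edge_deleted:
  assumes uv: "(u, v) \<in> parcs G"
  shows "(u, v) \<in> (edge_deleted_arcs G e)\<^sup>*"
proof (cases "{u, v} = e")
  case False
  then show ?thesis
    using uv by (auto simp: edge_deleted_arcs_def)
next
  case e: True
  have keep: "(x, y) \<in> edge_deleted_arcs G e" if "(x, y) \<in> parcs G" "{x, y} \<noteq> {u, v}" for x y
    using that e by (auto simp: edge_deleted_arcs_def)
  have vu: "(v, u) \<in> parcs G" and "u \<noteq> v"
    using uv by (auto dest: arcs_symmetric no_loops')
  show ?thesis
  proof (cases "l = 1")
    case True
    then obtain w where w: "(u, w) \<in> parcs G" "(v, w) \<in> parcs G"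
      using triangle_exists uv by blast
    then have "w \<noteq> u" "w \<noteq> v" "(w, v) \<in> parcs G"
      by (auto dest: arcs_symmetric no_loops')
    then have "(u, w) \<in> edge_deleted_arcs G e" "(w, v) \<in> edge_deleted_arcs G e"
      using w by (auto intro!: keep simp: doubleton_eq_iff)
    then show ?thesis
      by (meson converse_rtrancl_into_rtrancl r_into_rtrancl)
  next
    case False
    then have "l = 0" using l_01 by simp
    obtain a where a: "(u, a) \<in> parcs G" "a \<noteq> v"
      using third_neighbour[OF in_arcsD1[OF uv], of v v] by blast
    obtain b where b: "(v, b) \<in> parcs G" "b \<noteq> u"
      using third_neighbour[OF in_arcsD1[OF vu], of u u] by blast
    have au: "(a, u) \<in> parcs G" and bv: "(b, v) \<in> parcs G" and "a \<noteq> u" "b \<noteq> v"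
      using a b by (auto dest: arcs_symmetric no_loops')
    have av: "(v, a) \<notin> parcs G" and bu: "(u, b) \<notin> parcs G"
      using no_triangle[OF \<open>l = 0\<close> uv] no_triangle[OF \<open>l = 0\<close> vu] a b by auto
    then have "a \<noteq> b" using b by auto
    \<comment> \<open>The path \<open>v\<close>, \<open>u\<close>, \<open>a\<close> has nonadjacent
      ends, which forces \<mu> > 0.\<close>
    have "u \<in> common_neighbours G v a"
      using vu au by (auto simp: common_neighbours_def in_arcsD2)
    moreover have "card (common_neighbours G v a) = m"
      using nonadjacent[of v a] av a uv by (auto dest: in_arcsD2)
    ultimately have "m \<noteq> 0"
      using finite_common_neighbours[of v a] by (metis card_eq_0_iff empty_iff)
    have ua: "(u, a) \<in> edge_deleted_arcs G e" and bv': "(b, v) \<in> edge_deleted_arcs G e"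
      using a bv \<open>a \<noteq> v\<close> \<open>a \<noteq> u\<close> \<open>b \<noteq> v\<close> \<open>b \<noteq> u\<close> by (auto intro!: keep simp: doubleton_eq_iff)
    have "(a, b) \<in> (edge_deleted_arcs G e)\<^sup>*"
    proof (cases "(a, b) \<in> parcs G")
      case True
      then show ?thesis
        using \<open>a \<noteq> v\<close> \<open>a \<noteq> u\<close> by (auto intro!: keep simp: doubleton_eq_iff)
    next
      case False
      \<comment> \<open>Now \<mu> > 0 yields a path \<open>a\<close>, \<open>c\<close>,
        \<open>b\<close>. It avoids \<open>e\<close> because neither \<open>a\<close> nor
        \<open>b\<close> is an end of \<open>e\<close>.\<close>
      then have "card (common_neighbours G a b) = m"
        using nonadjacent[of a b] a b \<open>a \<noteq> b\<close> by (auto dest: in_arcsD2)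
      then have "common_neighbours G a b \<noteq> {}"
        using \<open>m \<noteq> 0\<close> by auto
      then obtain c where c: "(a, c) \<in> parcs G" "(b, c) \<in> parcs G"
        by (auto simp: common_neighbours_def)
      then have "(c, b) \<in> parcs G" by (auto dest: arcs_symmetric)
      then have "(a, c) \<in> edge_deleted_arcs G e" "(c, b) \<in> edge_deleted_arcs G e"
        using c \<open>a \<noteq> v\<close> \<open>a \<noteq> u\<close> \<open>b \<noteq> v\<close> \<open>b \<noteq> u\<close> by (auto intro!: keep simp: doubleton_eq_iff)
      then show ?thesis
        by (meson converse_rtrancl_into_rtrancl r_into_rtrancl)
    qed
    with ua bv' show ?thesis
      by (meson converse_rtrancl_into_rtrancl rtrancl.rtrancl_into_rtrancl)
  qed
qed

lemma edge_deleted_connected: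
  assumes "(u, v) \<in> (parcs G)\<^sup>*"
  shows "(u, v) \<in> (edge_deleted_arcs G e)\<^sup>*"
  using assms by induct (auto intro: rtrancl_trans ends_connected_edge_deleted)

text \<open>Induction along the walk: each edge \<open>{v, w}\<close> of it differs from
  \<open>e\<close> and belongs to the stars of both its ends, so it passes from one star to the
  next.\<close>

lemma stars_connected:
  assumes "(u, v) \<in> (edge_deleted_arcs G e)\<^sup>*"
    and ux: "(u, x) \<in> parcs G" "{u, x} \<noteq> e"
    and vy: "(v, y) \<in> parcs G" "{v, y} \<noteq> e"
  shows "({u, x}, {v, y}) \<in> (gallai_deleted_arcs G e)\<^sup>*"
  using assms(1) vy
proof (induct arbitrary: y)
  case base
  then show ?case using star_connected[OF ux] by blast
next
  case (step v w)
  then have vw: "(v, w) \<in> parcs G" "{v, w} \<noteq> e"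
    by (auto simp: edge_deleted_arcs_def)
  have "({u, x}, {v, w}) \<in> (gallai_deleted_arcs G e)\<^sup>*"
    using step vw by blast
  moreover have "({w, v}, {w, y}) \<in> (gallai_deleted_arcs G e)\<^sup>*"
    using star_connected[of w v e y] vw step.prems arcs_symmetric
    by (auto simp: insert_commute)
  ultimately show ?case
    by (simp add: insert_commute)
qed

lemma connected_del_vert_gallai_graph:
  assumes "Digraph_Component.connected (with_proj G)" and "parcs G \<noteq> {}"
  shows "Digraph_Component.connected (pre_digraph.del_vert (with_proj (gallai_graph G)) e)"
    (is "Digraph_Component.connected ?H")
proof -
  interpret gallai: pair_graph "gallai_graph G"
    by (rule pair_graph_gallai_graph) (rule pair_graph)
  interpret H: wf_digraph ?H
    by (rule gallai.wf_digraph_del_vert)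
  have verts_H: "verts ?H = undirected_edges G - {e}"
    by (simp add: pre_digraph.del_vert_simps gallai_graph_def)
  show ?thesis
  proof (rule H.connectedI_rtrancl)
    obtain u v where uv: "(u, v) \<in> parcs G"
      using assms(2) by auto
    \<comment> \<open>A second edge at \<open>u\<close> ensures that some edge survives the deletion
      of \<open>e\<close>.\<close>
    obtain z where z: "(u, z) \<in> parcs G" "z \<noteq> v"
      using third_neighbour[OF in_arcsD1[OF uv], of v v] by blast
    then have "{u, v} \<noteq> e \<or> {u, z} \<noteq> e"
      by (auto simp: doubleton_eq_iff)
    then show "verts ?H \<noteq> {}"
      using uv z by (auto simp: verts_H dest: edge_in_undirected_edges)
  next
    fix f g assume "f \<in> verts ?H" "g \<in> verts ?H"
    then obtain u x v y where f: "f = {u, x}" "(u, x) \<in> parcs G" "{u, x} \<noteq> e"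
      and g: "g = {v, y}" "(v, y) \<in> parcs G" "{v, y} \<noteq> e"
      by (auto simp: verts_H undirected_edges_def)
    have "u \<rightarrow>\<^sup>*\<^bsub>with_proj G\<^esub> v"
      using symmetric_connected_imp_strongly_connected[OF pair_sym_arcs assms(1)]
        in_arcsD1[OF f(2)] in_arcsD1[OF g(2)] by auto
    then have "(u, v) \<in> (parcs G)\<^sup>*"
      using reachable_rtranclI by fastforce
    from stars_connected[OF edge_deleted_connected[OF this] f(2,3) g(2,3)]
    show "(f, g) \<in> (arcs_ends ?H)\<^sup>*"
      by (simp add: arcs_ends_del_vert_gallai_graph f g)
  qed
qed

end

theorem theorem5:
  fixes G :: "'a pair_pre_digraph" and n k l m :: nat
  assumes "strongly_regular G n k l m"
    and "Digraph_Component.connected (with_proj G)"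
    and "k \<ge> 3"
    and "l = 0 \<or> l = 1"
  shows "two_connected (with_proj (gallai_graph G))"
proof -
  interpret pair_graph G
    using assms(1) by (simp add: strongly_regular_def)
  interpret sparse_srg G k l m
    using assms(1,3,4) unfolding strongly_regular_def
    by unfold_locales (metis in_arcsD1 in_arcsD2)+
  have "parcs G \<noteq> {}"
    using assms(1) by (simp add: strongly_regular_def)
  note del = connected_del_vert_gallai_graph[OF assms(2) this]
  \<comment> \<open>The empty set is not an edge, so deleting it leaves the Gallai graph unchanged
    and \<open>del\<close> also gives the connectedness of the whole graph.\<close>
  have "{} \<notin> undirected_edges G"
    by (auto simp: undirected_edges_def)
  then have "pre_digraph.del_vert (with_proj (gallai_graph G)) {} = with_proj (gallai_graph G)"
    by (intro pre_digraph.equality) (auto simp: pre_digraph.del_vert_simps gallai_graph_def)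
  with del[of "{}"] del show ?thesis
    by (simp add: two_connected_def)
qed

end
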